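(* Consider the discrete two-contour system with parameters $n$, $d$, $l_1$, $l_2$ defined in the context. If $$l_1+l_2\le n,$$ then the system results in a state of free movement from any (admissible) initial state; that is, for every admissible initial state $x(0)$ there is a time $t_0$ such that from time $t_0$ on every particle of both clusters moves at every step.
   Context: Two-contour system. Let $n$ be a positive integer, let $d$ be an integer with $1\le d\le n/2$, and let $l_1,l_2$ be integers with $1\le l_1\le l_2<n$. There are two closed contours, contour 1 and contour 2, each having $n$ cells with indices $0,1,\dots,n-1$ numbered modulo $n$ in the direction of movement. Contour $i$ carries one cluster (cluster $i$), consisting of $l_i$ particles which at every time are located in $l_i$ consecutive cells. The state at time $t=0,1,2,\dots$ is $x(t)=(x_1(t),x_2(t))\in\{0,\dots,n-1\}^2$, where $x_i(t)$ is the index of the cell occupied by the leading particle of cluster $i$; thus cluster $i$ occupies the cells $x_i(t),x_i(t)-1,\dots,x_i(t)-l_i+1$ modulo $n$ of contour $i$. The contours have two common points, called nodes. For each contour, node 1 is located between cells $n-1$ and $0$, and node 2 is located between cells $d-1$ and $d$. Cluster $i$ is at node 1 (at node 2) if its leading particle is in cell $n-1$ (in cell $d-1$). Cluster $i$ occupies a node if the node lies between two particles of cluster $i$ (for node 1: cells $n-1$ and $0$ of contour $i$ both contain particles of cluster $i$; for node 2: cells $d-1$ and $d$ both do). A state is admissible if no node is occupied by both clusters; the initial state $x(0)$ must be admissible. Dynamics. At each time step $t\to t+1$ both clusters are updated simultaneously. Each cluster moves one cell in the direction of movement ($x_i(t+1)=x_i(t)+1$ modulo $n$), with the following exceptions: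 (a) if at time $t$ cluster $i$ is at a node and the other cluster $j\ne i$ occupies this node, then cluster $i$ does not move ($x_i(t+1)=x_i(t)$); (b) if at time $t$ both clusters are at the same node, then only cluster 1 moves. The system is in a state of free movement from the moment $t_0$ if at every time $t\ge t_0$ every particle moves. *)

theory Defs
  imports Main
begin

datatype node = Node1 | Node2

text \<open>A node separates two consecutive cells; the cell after it is the one that a cluster
  waiting at the node would enter next.\<close>

fun cell_before :: "nat \<Rightarrow> nat \<Rightarrow> node \<Rightarrow> nat" where
  "cell_before n d Node1 = n - 1"
| "cell_before n d Node2 = d - 1"

fun cell_after :: "nat \<Rightarrow> nat \<Rightarrow> node \<Rightarrow> nat" where
  "cell_after n d Node1 = 0"
| "cell_after n d Node2 = d"

text \<open>Cells \<open>x, x - 1, \<dots>, x - l + 1\<close> modulo \<open>n\<close>. Adding \<open>n\<close> before subtracting keeps the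
  subtraction on naturals exact, since \<open>k < l < n\<close> in all uses.\<close>

definition cluster_cells :: "nat \<Rightarrow> nat \<Rightarrow> nat \<Rightarrow> nat set" where
  "cluster_cells n l x = {(x + n - k) mod n | k. k < l}"

definition at_node :: "nat \<Rightarrow> nat \<Rightarrow> nat \<Rightarrow> node \<Rightarrow> bool" where
  "at_node n d x v \<longleftrightarrow> x = cell_before n d v"

definition occupies_node :: "nat \<Rightarrow> nat \<Rightarrow> nat \<Rightarrow> nat \<Rightarrow> node \<Rightarrow> bool" where
  "occupies_node n d l x v \<longleftrightarrow>
     cell_before n d v \<in> cluster_cells n l x \<and> cell_after n d v \<in> cluster_cells n l x"

text \<open>A state is the pair of the cell indices of the two leading particles.\<close>

type_synonym state = "nat \<times> nat"

definition admissible :: "nat \<Rightarrow> nat \<Rightarrow> nat \<Rightarrow> nat \<Rightarrow> state \<Rightarrow> bool" where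
  "admissible n d l1 l2 = (\<lambda>(x1, x2).
     x1 < n \<and> x2 < n \<and>
     (\<forall>v. \<not> (occupies_node n d l1 x1 v \<and> occupies_node n d l2 x2 v)))"

text \<open>When both clusters are at the same node, cluster 1 has priority; hence the asymmetry
  between the two following definitions.\<close>

definition moves1 :: "nat \<Rightarrow> nat \<Rightarrow> nat \<Rightarrow> nat \<Rightarrow> state \<Rightarrow> bool" where
  "moves1 n d l1 l2 = (\<lambda>(x1, x2).
     \<not> (\<exists>v. at_node n d x1 v \<and> occupies_node n d l2 x2 v))"

definition moves2 :: "nat \<Rightarrow> nat \<Rightarrow> nat \<Rightarrow> nat \<Rightarrow> state \<Rightarrow> bool" where
  "moves2 n d l1 l2 = (\<lambda>(x1, x2).
     \<not> (\<exists>v. at_node n d x2 v \<and> occupies_node n d l1 x1 v) \<and>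
     \<not> (\<exists>v. at_node n d x1 v \<and> at_node n d x2 v))"

definition step :: "nat \<Rightarrow> nat \<Rightarrow> nat \<Rightarrow> nat \<Rightarrow> state \<Rightarrow> state" where
  "step n d l1 l2 s =
     (if moves1 n d l1 l2 s then (fst s + 1) mod n else fst s,
      if moves2 n d l1 l2 s then (snd s + 1) mod n else snd s)"

definition trajectory :: "nat \<Rightarrow> nat \<Rightarrow> nat \<Rightarrow> nat \<Rightarrow> state \<Rightarrow> nat \<Rightarrow> state" where
  "trajectory n d l1 l2 s t = (step n d l1 l2 ^^ t) s"

definition free_movement_from ::
    "nat \<Rightarrow> nat \<Rightarrow> nat \<Rightarrow> nat \<Rightarrow> (nat \<Rightarrow> state) \<Rightarrow> nat \<Rightarrow> bool" where
  "free_movement_from n d l1 l2 x t0 \<longleftrightarrow>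
     (\<forall>t\<ge>t0. moves1 n d l1 l2 (x t) \<and> moves2 n d l1 l2 (x t))"

end

theory Submission
  imports Defs
begin

text \<open>Both nodes sit at the same position on both contours, so whether and by whom a cluster can
  be delayed depends only on the gap from cluster 1 to cluster 2. For a gap strictly between
  \<open>0\<close> and \<open>l2\<close> only cluster 1 can be delayed, which increases the gap; for a gap \<open>0\<close> or greater than
  \<open>n - l1\<close> only cluster 2 can be delayed, which decreases the gap modulo \<open>n\<close>; for a gap in
  \<open>[l2, n - l1]\<close> nothing is delayed. As \<open>l2 \<le> n - l1\<close>, the distance of the gap
  from this interval drops at each delay, so there are only finitely many delays.\<close>

text \<open>The cyclic difference \<open>x - y\<close> modulo \<open>n\<close>, split into cases
  instead of using \<open>mod\<close> so that goals about it reduce to linear arithmetic.\<close>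

definition gap :: "nat \<Rightarrow> nat \<Rightarrow> nat \<Rightarrow> nat" where
  "gap n y x = (if y \<le> x then x - y else x + n - y)"

lemma gap_less: "y < n \<Longrightarrow> x < n \<Longrightarrow> gap n y x < n"
  by (auto simp: gap_def)

lemma gap_commute:
  assumes "x < n" "y < n" "x \<noteq> y"
  shows "gap n x y = n - gap n y x"
  using assms by (auto simp: gap_def)

lemma Suc_mod_eq: "x < n \<Longrightarrow> (x + 1) mod n = (if x + 1 = n then 0 else x + 1)" for x n :: nat
  by auto

lemma gap_Suc_Suc:
  assumes "x < n" "y < n"
  shows "gap n ((y + 1) mod n) ((x + 1) mod n) = gap n y x"
  unfolding Suc_mod_eq[OF assms(1)] Suc_mod_eq[OF assms(2)]
  using assms by (auto simp: gap_def)

lemma gap_Suc_right: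
  assumes "x < n" "y < n"
  shows "gap n y ((x + 1) mod n) = (gap n y x + 1) mod n"
  unfolding Suc_mod_eq[OF assms(1)] Suc_mod_eq[OF gap_less[OF assms(2,1)]]
  using assms by (auto simp: gap_def)

lemma gap_Suc_left:
  assumes "x < n" "y < n"
  shows "gap n ((y + 1) mod n) x = (if gap n y x = 0 then n - 1 else gap n y x - 1)"
  unfolding Suc_mod_eq[OF assms(2)]
  using assms by (auto simp: gap_def)

lemma mem_cluster_cells_iff:
  assumes "x < n" "c < n" "l < n"
  shows "c \<in> cluster_cells n l x \<longleftrightarrow> gap n c x < l"
proof
  assume "c \<in> cluster_cells n l x"
  then obtain k where k: "k < l" "c = (x + n - k) mod n"
    by (auto simp: cluster_cells_def)
  have "c = (if k \<le> x then x - k else x + n - k)"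
  proof (cases "k \<le> x")
    case True
    then have "x + n - k = x - k + n" by simp
    then have "(x + n - k) mod n = (x - k) mod n" by (simp only: mod_add_self2)
    also have "\<dots> = x - k" using assms(1) by simp
    finally show ?thesis using True unfolding k(2) by (simp only: if_True)
  qed (use k assms in simp)
  then have "gap n c x = k"
    using k(1) assms by (auto simp: gap_def split: if_splits)
  with k(1) show "gap n c x < l" by simp
next
  assume "gap n c x < l"
  moreover have "c = (x + n - gap n c x) mod n"
    using assms by (auto simp: gap_def)
  ultimately show "c \<in> cluster_cells n l x"
    by (auto simp: cluster_cells_def)
qed

lemma cell_before_less: "0 < n \<Longrightarrow> d < n \<Longrightarrow> cell_before n d v < n"
  by (cases v) auto

lemma cell_after_eq: "1 \<le> d \<Longrightarrow> d < n \<Longrightarrow> cell_after n d v = (cell_before n d v + 1) mod n"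
  by (cases v) auto

text \<open>The cell after the node is one step closer to the leader, so its gap is one smaller. Gap
  \<open>0\<close> wraps to \<open>n - 1\<close>, which is at least \<open>l\<close>: a cluster
  waiting at a node does not yet occupy it.\<close>

lemma occupies_node_iff:
  assumes "1 \<le> d" "d < n" "l < n" "x < n"
  shows "occupies_node n d l x v \<longleftrightarrow>
           0 < gap n (cell_before n d v) x \<and> gap n (cell_before n d v) x < l"
proof -
  have b: "cell_before n d v < n"
    using assms cell_before_less by simp
  have a: "cell_after n d v = (cell_before n d v + 1) mod n"
    using assms(1,2) by (rule cell_after_eq)
  have "cell_after n d v < n" using a assms by simp
  with b have "occupies_node n d l x v \<longleftrightarrow>
      gap n (cell_before n d v) x < l \<and> gap n (cell_after n d v) x < l"
    using assms by (simp add: occupies_node_def mem_cluster_cells_iff)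
  then show ?thesis
    unfolding a gap_Suc_left[OF assms(4) b] using assms by auto
qed

text \<open>A stopped cluster has its leader in the cell before the node, so the other cluster's gap
  from the node is the gap between the leaders.\<close>

lemma not_moves1_gap:
  assumes "1 \<le> d" "d < n" "l2 < n" "x1 < n" "x2 < n"
    and "\<not> moves1 n d l1 l2 (x1, x2)"
  shows "0 < gap n x1 x2" "gap n x1 x2 < l2"
  using assms by (auto simp: moves1_def at_node_def occupies_node_iff)

lemma not_moves2_gap:
  assumes "1 \<le> d" "d < n" "l1 < n" "x1 < n" "x2 < n"
    and "\<not> moves2 n d l1 l2 (x1, x2)"
  shows "gap n x1 x2 = 0 \<or> n - l1 < gap n x1 x2"
proof (cases "x1 = x2")
  \<comment> \<open>Distinct leaders cannot be at the same node, so the tie rule is excluded and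
    cluster 1 occupies the node where cluster 2 waits.\<close>
  case False
  with assms have "gap n x2 x1 < l1"
    by (auto simp: moves2_def at_node_def occupies_node_iff)
  moreover have "gap n x1 x2 = n - gap n x2 x1"
    using assms False by (intro gap_commute) auto
  ultimately show ?thesis using assms by linarith
qed (simp add: gap_def)

text \<open>The distance of the gap from \<open>[l2, n - l1]\<close>; a gap \<open>0\<close> counts as \<open>n\<close>,
  because cluster 2 yields when both clusters meet at a node. The last subtraction truncates
  to \<open>0\<close> inside the interval.\<close>

definition excess :: "nat \<Rightarrow> nat \<Rightarrow> nat \<Rightarrow> state \<Rightarrow> nat" where
  "excess n l1 l2 = (\<lambda>(x1, x2). let g = gap n x1 x2 in
     if g = 0 then l1 else if g < l2 then l2 - g else g - (n - l1))"

lemma step_less: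
  assumes "0 < n" "fst s < n" "snd s < n"
  shows "fst (step n d l1 l2 s) < n" "snd (step n d l1 l2 s) < n"
  using assms by (auto simp: step_def)

lemma excess_step:
  assumes "1 \<le> d" "d < n" "1 \<le> l1" "l2 < n" "l1 + l2 \<le> n" "l1 < n"
    and "fst s < n" "snd s < n"
  shows "excess n l1 l2 (step n d l1 l2 s) \<le> excess n l1 l2 s"
    and "\<not> (moves1 n d l1 l2 s \<and> moves2 n d l1 l2 s) \<Longrightarrow>
           excess n l1 l2 (step n d l1 l2 s) < excess n l1 l2 s"
proof -
  obtain x1 x2 where s: "s = (x1, x2)" by (cases s)
  with assms have x: "x1 < n" "x2 < n" by auto
  note m1 = not_moves1_gap[OF assms(1,2,4) x, of l1]
  note m2 = not_moves2_gap[OF assms(1,2,6) x, of l2]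
  have g: "gap n x1 x2 < n" using x by (rule gap_less)
  consider (both) "moves1 n d l1 l2 s" "moves2 n d l1 l2 s"
    | (stop1) "\<not> moves1 n d l1 l2 s" "moves2 n d l1 l2 s"
    | (stop2) "moves1 n d l1 l2 s" "\<not> moves2 n d l1 l2 s"
    | (none) "\<not> moves1 n d l1 l2 s" "\<not> moves2 n d l1 l2 s"
    by blast
  then have "excess n l1 l2 (step n d l1 l2 s) \<le> excess n l1 l2 s \<and>
      (\<not> (moves1 n d l1 l2 s \<and> moves2 n d l1 l2 s) \<longrightarrow>
        excess n l1 l2 (step n d l1 l2 s) < excess n l1 l2 s)"
  proof cases
    case both
    then have "step n d l1 l2 s = ((x1 + 1) mod n, (x2 + 1) mod n)"
      by (simp add: step_def s)
    then have "excess n l1 l2 (step n d l1 l2 s) = excess n l1 l2 s"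
      by (simp only: excess_def s prod.case gap_Suc_Suc[OF x(2,1)])
    with both show ?thesis by simp
  next
    case stop1
    then have st: "step n d l1 l2 s = (x1, (x2 + 1) mod n)"
      by (simp add: step_def s)
    have "0 < gap n x1 x2" "gap n x1 x2 < l2" using m1 stop1 s by auto
    moreover from this assms(4) have "(gap n x1 x2 + 1) mod n = gap n x1 x2 + 1" by simp
    then have "gap n x1 ((x2 + 1) mod n) = gap n x1 x2 + 1"
      using gap_Suc_right[OF x(2,1)] by simp
    \<comment> \<open>From gap \<open>l2 - 1\<close> the new gap is \<open>l2\<close>, which falls
      under the last clause of \<open>excess\<close> and gives \<open>0\<close> because
      \<open>l2 \<le> n - l1\<close>.\<close>
    ultimately have "excess n l1 l2 (step n d l1 l2 s) < excess n l1 l2 s"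
      unfolding st unfolding s excess_def prod.case Let_def using assms(5) by auto
    then show ?thesis by simp
  next
    case stop2
    then have st: "step n d l1 l2 s = ((x1 + 1) mod n, x2)"
      by (simp add: step_def s)
    have "gap n x1 x2 = 0 \<or> n - l1 < gap n x1 x2" using m2 stop2 s by auto
    \<comment> \<open>Gap \<open>0\<close> wraps to \<open>n - 1\<close>, lowering the excess from
      \<open>l1\<close> to \<open>l1 - 1\<close>. Otherwise the new gap is still at least
      \<open>n - l1 \<ge> l2\<close>.\<close>
    with gap_Suc_left[OF x(2,1)] g
    have "excess n l1 l2 (step n d l1 l2 s) < excess n l1 l2 s"
      unfolding st unfolding s excess_def prod.case Let_def using assms(3-6) by auto
    then show ?thesis by simp
  next
    case none
    \<comment> \<open>Mutual blocking would put the gap in two ranges that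
      \<open>l1 + l2 \<le> n\<close> makes disjoint.\<close>
    then have "0 < gap n x1 x2" "gap n x1 x2 < l2" "gap n x1 x2 = 0 \<or> n - l1 < gap n x1 x2"
      using m1 m2 s by auto
    then show ?thesis using assms(5) by linarith
  qed
  then show "excess n l1 l2 (step n d l1 l2 s) \<le> excess n l1 l2 s"
    and "\<not> (moves1 n d l1 l2 s \<and> moves2 n d l1 l2 s) \<Longrightarrow>
           excess n l1 l2 (step n d l1 l2 s) < excess n l1 l2 s"
    by blast+
qed

theorem theorem1:
  fixes n d l1 l2 :: nat
  assumes "0 < n"
    and "1 \<le> d" and "2 * d \<le> n"
    and "1 \<le> l1" and "l1 \<le> l2" and "l2 < n"
    and "l1 + l2 \<le> n"
  shows "\<forall>x0. admissible n d l1 l2 x0 \<longrightarrow>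
           (\<exists>t0. free_movement_from n d l1 l2 (trajectory n d l1 l2 x0) t0)"
proof (intro allI impI)
  fix x0
  assume adm: "admissible n d l1 l2 x0"
  define X where "X = trajectory n d l1 l2 x0"
  define f where "f t = excess n l1 l2 (X t)" for t
  have X_Suc: "X (Suc t) = step n d l1 l2 (X t)" for t
    by (simp add: X_def trajectory_def)
  have less: "fst (X t) < n \<and> snd (X t) < n" for t
  proof (induction t)
    case 0
    show ?case using adm by (auto simp: X_def trajectory_def admissible_def)
  next
    case (Suc t)
    then show ?case using assms(1) step_less by (simp add: X_Suc)
  qed
  have "d < n" "l1 < n" using assms by auto
  note excess_step = excess_step[OF assms(2) \<open>d < n\<close> assms(4,6,7) \<open>l1 < n\<close>]
  have mono: "f (Suc t) \<le> f t" for t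
    unfolding f_def X_Suc using less by (intro excess_step(1)) auto
  have delay: "f (Suc t) < f t"
    if "\<not> (moves1 n d l1 l2 (X t) \<and> moves2 n d l1 l2 (X t))" for t
    unfolding f_def X_Suc using less that by (intro excess_step(2)) auto
  \<comment> \<open>At \<open>t0\<close> the excess is least along the trajectory; any later delay
    would push it below this minimum.\<close>
  obtain t0 where min: "f t0 \<le> f t" for t
    using ex_has_least_nat[of "\<lambda>_. True" 0 f] by auto
  have "moves1 n d l1 l2 (X t) \<and> moves2 n d l1 l2 (X t)" if "t0 \<le> t" for t
  proof (rule ccontr)
    assume "\<not> ?thesis"
    then have "f (Suc t) < f t" by (rule delay)
    also have "f t \<le> f t0"
      using mono that by (rule lift_Suc_antimono_le)
    finally show False using min[of "Suc t"] by simp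
  qed
  then show "\<exists>t0. free_movement_from n d l1 l2 (trajectory n d l1 l2 x0) t0"
    unfolding free_movement_from_def X_def by blast
qed

end
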